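(* For each integer $t$, there is a bipartite graph $G$ such that $dis[G]>t$.
   Context: All graphs are finite, undirected, without loops or multiple edges. For a vertex $v$ of a graph $G$, $N[v]$ denotes the closed neighborhood of $v$ (i.e. $v$ together with its neighbors). A labeling $f$ of $V(G)$ by numbers is closed distinguishing if for any two adjacent vertices $u,v$ with $N[u]\neq N[v]$ we have $\sum_{w\in N[u]} f(w)\neq \sum_{w\in N[v]} f(w)$. The closed distinguishing number $dis[G]$ is the smallest positive integer $k$ such that $G$ has a closed distinguishing labeling $f:V(G)\to\{1,2,\ldots,k\}$. *)

theory Defs
  imports "Graph_Theory.Pair_Digraph"
begin

text \<open>
  Finite simple undirected graphs are the library's \<^locale>\<open>pair_graph\<close>s: finite, loop-free
  digraphs whose arc set is a symmetric set of pairs of vertices; an edge between u and v is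
  the pair of arcs (u, v) and (v, u).
\<close>

definition bipartite :: "'a pair_pre_digraph \<Rightarrow> bool" where
  "bipartite G \<longleftrightarrow>
     (\<exists>A B. A \<union> B = pverts G \<and> A \<inter> B = {} \<and>
        (\<forall>(u, v) \<in> parcs G. (u \<in> A \<and> v \<in> B) \<or> (u \<in> B \<and> v \<in> A)))"

definition closed_nbhd :: "'a pair_pre_digraph \<Rightarrow> 'a \<Rightarrow> 'a set" where
  "closed_nbhd G v = insert v {w. (v, w) \<in> parcs G}"

definition closed_distinguishing :: "'a pair_pre_digraph \<Rightarrow> ('a \<Rightarrow> nat) \<Rightarrow> bool" where
  "closed_distinguishing G f \<longleftrightarrow>
     (\<forall>(u, v) \<in> parcs G. closed_nbhd G u \<noteq> closed_nbhd G v \<longrightarrow>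
        (\<Sum>w \<in> closed_nbhd G u. f w) \<noteq> (\<Sum>w \<in> closed_nbhd G v. f w))"

text \<open>
  The minimum is attained for every \<^locale>\<open>pair_graph\<close>: labeling the vertices with distinct
  powers of two gives different sums on different closed neighborhoods.
\<close>

definition dis :: "'a pair_pre_digraph \<Rightarrow> nat" where
  "dis G = (LEAST k. k \<ge> 1 \<and> (\<exists>f \<in> pverts G \<rightarrow> {1..k}. closed_distinguishing G f))"

end

theory Submission
  imports Defs "HOL-Library.Nat_Bijection"
begin

text \<open>
  Let two adjacent vertices a and b have no further neighbors than a set R for a and a set R' for b.
  Their own labels occur in both closed sums, so the sums agree iff R and R' have the same label sum.
  Take two pools of t * t vertices each and one such edge for every subset R of the first
  pool and R' of the second. A labeling by 1, ..., t has t equal labels x in the first pool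
  and t equal labels y in the second; y vertices labeled x and x vertices labeled y have equal sums.
\<close>

text \<open>Pigeonhole: if every fibre had fewer than \<open>t\<close> elements, the
  \<open>t\<close> fibres could not cover \<open>t * t\<close> points. A large fibre is then cut
  down to exactly \<open>t\<close> elements.\<close>

lemma exists_const_subset:
  fixes f :: "'a \<Rightarrow> nat"
  assumes "finite P" and "card P \<ge> t * t" and "f \<in> P \<rightarrow> {1..t}" and "t \<ge> 1"
  obtains x Q where "x \<in> {1..t}" "Q \<subseteq> P" "card Q = t" "\<And>q. q \<in> Q \<Longrightarrow> f q = x"
proof -
  obtain x where "x \<in> {1..t}" "card P \<le> card (f -` {x} \<inter> P) * t"
    using pigeonhole_card[OF assms(3,1)] assms(4) by auto
  moreover from this have "t * t \<le> card (f -` {x} \<inter> P) * t"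
    using assms(2) by linarith
  then have "t \<le> card (f -` {x} \<inter> P)"
    using assms(4) by simp
  then obtain Q where "Q \<subseteq> f -` {x} \<inter> P" "card Q = t"
    by (meson obtain_subset_with_card_n)
  ultimately show thesis
    using that[of x Q] by blast
qed

lemma exists_equal_subset_sums:
  fixes f :: "'a \<Rightarrow> nat" and g :: "'b \<Rightarrow> nat"
  assumes "finite P" "card P \<ge> t * t" "f \<in> P \<rightarrow> {1..t}"
    and "finite Q" "card Q \<ge> t * t" "g \<in> Q \<rightarrow> {1..t}" and "t \<ge> 1"
  obtains R S where "R \<subseteq> P" "S \<subseteq> Q" "R \<noteq> {}" "sum f R = sum g S"
proof -
  obtain x P' where P': "x \<in> {1..t}" "P' \<subseteq> P" "card P' = t" "\<And>p. p \<in> P' \<Longrightarrow> f p = x"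
    using exists_const_subset assms(1,2,3,7) by metis
  obtain y Q' where Q': "y \<in> {1..t}" "Q' \<subseteq> Q" "card Q' = t" "\<And>q. q \<in> Q' \<Longrightarrow> g q = y"
    using exists_const_subset assms(4,5,6,7) by metis
  \<comment> \<open>The sizes are swapped: \<open>y\<close> labels \<open>x\<close> against
    \<open>x\<close> labels \<open>y\<close>, both summing to \<open>x * y\<close>. The constant
    sets are large enough because labels are at most \<open>t\<close>.\<close>
  obtain R where R: "R \<subseteq> P'" "card R = y"
    using obtain_subset_with_card_n[of y P'] P'(3) Q'(1) by auto
  obtain S where S: "S \<subseteq> Q'" "card S = x"
    using obtain_subset_with_card_n[of x Q'] Q'(3) P'(1) by auto
  have "sum f R = (\<Sum>_\<in>R. x)"
    using P'(4) R(1) by (intro sum.cong) auto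
  moreover have "sum g S = (\<Sum>_\<in>S. y)"
    using Q'(4) S(1) by (intro sum.cong) auto
  \<comment> \<open>Labels are positive, so \<open>y\<close> is at least 1; later this makes the two
    closed neighborhoods differ.\<close>
  moreover have "R \<noteq> {}"
    using R(2) Q'(1) by auto
  ultimately show thesis
    using that[of R S] P'(2) Q'(2) R S by (simp add: mult.commute)
qed

text \<open>On natural numbers, the labeling by powers of two has the closed sums set_encode N[v].\<close>

lemma exists_closed_distinguishing:
  fixes G :: "nat pair_pre_digraph"
  assumes "pair_graph G"
  shows "\<exists>k\<ge>1. \<exists>f \<in> pverts G \<rightarrow> {1..k}. closed_distinguishing G f"
proof -
  interpret pair_graph G by fact
  define k :: nat where "k = Suc (\<Sum>v\<in>pverts G. 2 ^ v)"
  \<comment> \<open>\<open>set_encode\<close> is injective only on finite sets.\<close>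
  have fin: "finite (closed_nbhd G v)" for v
  proof -
    have "closed_nbhd G v \<subseteq> insert v (pverts G)"
      using in_arcsD2 by (auto simp: closed_nbhd_def)
    then show ?thesis
      by (meson finite_insert finite_subset pair_finite_verts)
  qed
  have "2 ^ v \<le> k" if "v \<in> pverts G" for v
    unfolding k_def using that pair_finite_verts
    by (intro le_SucI member_le_sum) auto
  then have "(^) 2 \<in> pverts G \<rightarrow> {1..k}"
    by auto
  moreover have "closed_distinguishing G ((^) 2)"
    unfolding closed_distinguishing_def
    using set_encode_eq[OF fin fin] by (auto simp: set_encode_def)
  moreover have "k \<ge> 1"
    by (simp add: k_def)
  ultimately show ?thesis
    by blast
qed

text \<open>\<open>LEAST\<close> satisfies its predicate once some admissible \<open>k\<close>
  exists.\<close>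

lemma dis_attained:
  fixes G :: "nat pair_pre_digraph"
  assumes "pair_graph G"
  shows "dis G \<ge> 1 \<and> (\<exists>f \<in> pverts G \<rightarrow> {1..dis G}. closed_distinguishing G f)"
  unfolding dis_def using LeastI_ex[OF exists_closed_distinguishing[OF assms]] .

text \<open>
  The pool vertices are the multiples 3 * k with k < n; the first pool consists of those with even k.
  Both sets R and R' are coded by their union S, and the edge for S joins 3 * set_encode S + 1
  and 3 * set_encode S + 2.
\<close>

definition pool_arcs :: "nat \<Rightarrow> (nat \<times> nat) set" where
  "pool_arcs n = (\<Union>S\<in>Pow {..<n}.
     {(3 * set_encode S + 1, 3 * set_encode S + 2)} \<union>
     (\<lambda>k. (3 * set_encode S + 1, 3 * k)) ` {k \<in> S. even k} \<union>
     (\<lambda>k. (3 * set_encode S + 2, 3 * k)) ` {k \<in> S. odd k})"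

definition pool_graph :: "nat \<Rightarrow> nat pair_pre_digraph" where
  "pool_graph n =
     \<lparr>pverts = Domain (pool_arcs n) \<union> Range (pool_arcs n) \<union> (*) 3 ` {..<n},
      parcs = pool_arcs n \<union> (pool_arcs n)\<inverse>\<rparr>"

lemma finite_pool_arcs: "finite (pool_arcs n)"
  unfolding pool_arcs_def
  by (intro finite_UN_I finite_UnI finite_imageI) (auto intro: finite_subset)

text \<open>The two ends of an arc have different residues mod 3.\<close>

lemma pool_arcs_irrefl: "(u, u) \<notin> pool_arcs n"
  unfolding pool_arcs_def by (auto; presburger)

lemma pair_graph_pool_graph: "pair_graph (pool_graph n)"
  by unfold_locales
    (auto simp: pool_graph_def finite_pool_arcs finite_Domain finite_Range pool_arcs_irrefl
      symmetric_def intro!: symI)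

lemma bipartite_pool_graph: "bipartite (pool_graph n)"
proof -
  \<comment> \<open>One side holds the vertices \<open>3 * i + 1\<close> and the second pool (odd
    multiples of 3), the other the vertices \<open>3 * i + 2\<close> and the first pool.\<close>
  define side :: "nat \<Rightarrow> bool" where "side v \<longleftrightarrow> v mod 3 = 1 \<or> v mod 6 = 3" for v
  have "side (3 * i + 1)" "\<not> side (3 * i + 2)" "side (3 * i) \<longleftrightarrow> odd i" for i
    unfolding side_def by presburger+
  then have "side u \<noteq> side v" if "(u, v) \<in> pool_arcs n" for u v
    using that unfolding pool_arcs_def by auto
  then have "\<forall>(u, v) \<in> parcs (pool_graph n). side u \<noteq> side v"
    by (auto simp: pool_graph_def)
  moreover have "u \<in> pverts (pool_graph n)" "v \<in> pverts (pool_graph n)"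
    if "(u, v) \<in> parcs (pool_graph n)" for u v
    using that by (auto simp: pool_graph_def)
  ultimately show ?thesis
    unfolding bipartite_def
    by (intro exI[of _ "{v \<in> pverts (pool_graph n). side v}"]
        exI[of _ "{v \<in> pverts (pool_graph n). \<not> side v}"]) blast
qed

text \<open>Residues mod 3 tell the kinds of vertices apart, and injectivity of
  \<open>set_encode\<close> on finite sets ensures that only the arcs built for \<open>S\<close>
  touch \<open>a\<close> and \<open>b\<close>.\<close>

lemma closed_nbhd_pool_graph:
  assumes "S \<subseteq> {..<n}"
  defines "a \<equiv> 3 * set_encode S + 1" and "b \<equiv> 3 * set_encode S + 2"
  shows "closed_nbhd (pool_graph n) a = {a, b} \<union> (*) 3 ` {k \<in> S. even k}"
    and "closed_nbhd (pool_graph n) b = {a, b} \<union> (*) 3 ` {k \<in> S. odd k}"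
proof -
  have eq: "set_encode T = set_encode S \<longleftrightarrow> T = S" "set_encode S = set_encode T \<longleftrightarrow> S = T"
    if "T \<subseteq> {..<n}" for T
    using that assms(1) by (meson finite_lessThan finite_subset set_encode_eq)+
  have ne: "3 * i + 1 \<noteq> 3 * j + (2::nat)" "3 * i + 2 \<noteq> 3 * j + (1::nat)"
    "3 * i + 1 \<noteq> 3 * (j::nat)" "3 * i + 2 \<noteq> 3 * (j::nat)"
    "3 * (j::nat) \<noteq> 3 * i + 1" "3 * (j::nat) \<noteq> 3 * i + 2" for i j
    by presburger+
  have "{w. (a, w) \<in> parcs (pool_graph n)} = insert b ((*) 3 ` {k \<in> S. even k})"
    using assms(1) ne by (auto simp: pool_graph_def pool_arcs_def a_def b_def eq)
  then show "closed_nbhd (pool_graph n) a = {a, b} \<union> (*) 3 ` {k \<in> S. even k}"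
    by (auto simp: closed_nbhd_def)
  have "{w. (b, w) \<in> parcs (pool_graph n)} = insert a ((*) 3 ` {k \<in> S. odd k})"
    using assms(1) ne by (auto simp: pool_graph_def pool_arcs_def a_def b_def eq)
  then show "closed_nbhd (pool_graph n) b = {a, b} \<union> (*) 3 ` {k \<in> S. odd k}"
    by (auto simp: closed_nbhd_def)
qed

lemma not_closed_distinguishing_pool_graph:
  assumes "t \<ge> 1" and f: "f \<in> pverts (pool_graph (2 * (t * t))) \<rightarrow> {1..t}"
  shows "\<not> closed_distinguishing (pool_graph (2 * (t * t))) f"
proof
  let ?n = "2 * (t * t)"
  assume cd: "closed_distinguishing (pool_graph ?n) f"
  define E where "E = (*) 2 ` {..<t * t}"
  define O' where "O' = (\<lambda>k. 2 * k + 1) ` {..<t * t}"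
  have pool: "f (3 * k) \<in> {1..t}" if "k < ?n" for k
    using f that by (auto simp: pool_graph_def)
  have lt: "E \<subseteq> {..<?n}" "O' \<subseteq> {..<?n}"
    by (auto simp: E_def O'_def)
  have "finite E" "card E = t * t"
    by (auto simp: E_def card_image inj_on_def)
  moreover have "finite O'" "card O' = t * t"
    by (auto simp: O'_def card_image inj_on_def)
  moreover have "(\<lambda>k. f (3 * k)) \<in> E \<rightarrow> {1..t}" "(\<lambda>k. f (3 * k)) \<in> O' \<rightarrow> {1..t}"
    using pool lt by blast+
  ultimately obtain R R' where R: "R \<subseteq> E" "R' \<subseteq> O'" "R \<noteq> {}"
    and sums: "(\<Sum>k\<in>R. f (3 * k)) = (\<Sum>k\<in>R'. f (3 * k))"
    using exists_equal_subset_sums[of E t "\<lambda>k. f (3 * k)" O' "\<lambda>k. f (3 * k)"] assms(1)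
    by (metis order_refl)
  \<comment> \<open>Parity recovers \<open>R\<close> and \<open>R'\<close> from the union.\<close>
  define S where "S = R \<union> R'"
  define a b where "a = 3 * set_encode S + 1" and "b = 3 * set_encode S + 2"
  have S: "S \<subseteq> {..<?n}"
    using R lt by (auto simp: S_def)
  have even: "{k \<in> S. even k} = R" and odd: "{k \<in> S. odd k} = R'"
    using R by (auto simp: S_def E_def O'_def)
  have fin: "finite R" "finite R'"
    using R \<open>finite E\<close> \<open>finite O'\<close> by (auto intro: finite_subset)
  have N: "closed_nbhd (pool_graph ?n) a = {a, b} \<union> (*) 3 ` R"
    "closed_nbhd (pool_graph ?n) b = {a, b} \<union> (*) 3 ` R'"
    using closed_nbhd_pool_graph[OF S] unfolding a_def b_def even odd by auto
  have disj: "{a, b} \<inter> (*) 3 ` X = {}" for X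
    unfolding a_def b_def by (auto; presburger)
  \<comment> \<open>The labels of \<open>a\<close> and \<open>b\<close> form a common summand, so
    only the pool sums are compared.\<close>
  have sum: "sum f ({a, b} \<union> (*) 3 ` X) = sum f {a, b} + (\<Sum>k\<in>X. f (3 * k))"
    if "finite X" for X
    using that disj by (subst sum.union_disjoint) (auto simp: sum.reindex inj_on_def)
  have "sum f (closed_nbhd (pool_graph ?n) a) = sum f (closed_nbhd (pool_graph ?n) b)"
    unfolding N sum[OF fin(1)] sum[OF fin(2)] sums ..
  moreover have "(a, b) \<in> parcs (pool_graph ?n)"
    using S by (auto simp: pool_graph_def pool_arcs_def a_def b_def)
  moreover have "closed_nbhd (pool_graph ?n) a \<noteq> closed_nbhd (pool_graph ?n) b"
  proof -
    obtain k where "k \<in> R"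
      using R(3) by blast
    moreover from this have "k \<notin> R'"
      using even odd by blast
    ultimately have "3 * k \<in> closed_nbhd (pool_graph ?n) a" "3 * k \<notin> closed_nbhd (pool_graph ?n) b"
      unfolding N using disj[of R] by auto
    then show ?thesis
      by blast
  qed
  ultimately show False
    using cd unfolding closed_distinguishing_def by blast
qed

theorem theorem6:
  shows "\<forall>t::int. \<exists>G :: nat pair_pre_digraph. pair_graph G \<and> bipartite G \<and> int (dis G) > t"
proof
  fix t :: int
  \<comment> \<open>The maximum covers nonpositive \<open>t\<close>, as the labeling argument needs
    a bound of at least 1.\<close>
  define s where "s = max 1 (nat t)"
  let ?G = "pool_graph (2 * (s * s))"
  have "s < dis ?G"
  proof (rule ccontr)
    assume "\<not> s < dis ?G"
    moreover obtain f where f: "f \<in> pverts ?G \<rightarrow> {1..dis ?G}" "closed_distinguishing ?G f"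
      using dis_attained[OF pair_graph_pool_graph] by blast
    \<comment> \<open>A smaller label range is contained in \<open>{1..s}\<close>, so excluding the
      bound \<open>s\<close> excludes all bounds below it.\<close>
    ultimately have "f \<in> pverts ?G \<rightarrow> {1..s}"
      by fastforce
    with f(2) show False
      using not_closed_distinguishing_pool_graph[of s f] by (simp add: s_def)
  qed
  then have "int (dis ?G) > t"
    unfolding s_def by linarith
  then show "\<exists>G :: nat pair_pre_digraph. pair_graph G \<and> bipartite G \<and> int (dis G) > t"
    using pair_graph_pool_graph bipartite_pool_graph by blast
qed

end
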